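(* Let $X$ be a finite set and let $f:2^X\to\mathbb{R}$ be a non-decreasing and submodular function with $f(\emptyset)=0$. For all $Y\subseteq X$ there is a strongly submodular function $g:2^X\to\mathbb{R}$ such that $g(A)\le f(A)$ for all $A\subseteq X$, and $g(A)=f(A)$ when $A=Y$ or $|A|\le 1$.
   Context: For a finite set $X$, a function $f:2^X\to\mathbb{R}$ is non-decreasing if $A\subseteq B$ implies $f(A)\le f(B)$; it is submodular if $f(A\cup B)+f(A\cap B)\le f(A)+f(B)$ for all $A,B\subseteq X$; it is strongly submodular if $$\sum_{K\subseteq\{1,\ldots,m\}}(-1)^{|K|}f\Big(A_0\cup\bigcup_{i\in K}A_i\Big)\le 0$$ for all $m\ge 1$ and all $A_0,A_1,\ldots,A_m\in 2^X$. *)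

theory Defs
  imports Complex_Main
begin

text \<open>
  A function \<open>2\<^sup>X \<rightarrow> \<real>\<close> is a function on \<^typ>\<open>'a set\<close> of which only the values on
  \<^term>\<open>Pow X\<close> matter; ``non-decreasing'' is \<^term>\<open>mono_on (Pow X) f\<close>.
\<close>

definition submodular_on :: "'a set \<Rightarrow> ('a set \<Rightarrow> real) \<Rightarrow> bool" where
  "submodular_on X f \<longleftrightarrow>
     (\<forall>A B. A \<subseteq> X \<longrightarrow> B \<subseteq> X \<longrightarrow> f (A \<union> B) + f (A \<inter> B) \<le> f A + f B)"

text \<open>The sets \<open>A\<^sub>0, A\<^sub>1, \<dots>, A\<^sub>m\<close> are arbitrary subsets of \<open>X\<close>, possibly empty or equal.\<close>

definition strongly_submodular_on :: "'a set \<Rightarrow> ('a set \<Rightarrow> real) \<Rightarrow> bool" where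
  "strongly_submodular_on X f \<longleftrightarrow>
     (\<forall>m::nat. \<forall>A :: nat \<Rightarrow> 'a set. m \<ge> 1 \<longrightarrow> (\<forall>i\<in>{0..m}. A i \<subseteq> X) \<longrightarrow>
        (\<Sum>K\<in>Pow {1..m}. (-1) ^ card K * f (A 0 \<union> (\<Union>i\<in>K. A i))) \<le> 0)"

end

theory Submission imports Defs begin

text \<open>
  The building blocks are the functions \<open>A \<mapsto> max\<^bsub>x\<in>A\<^esub> w x\<close> with weights \<open>w \<ge> 0\<close>. They turn unions
  into maxima, which makes them strongly submodular: in the alternating sum, adding to \<open>K\<close> the
  index of the set of least value among \<open>A\<^sub>1, \<dots>, A\<^sub>m\<close> changes nothing unless \<open>K\<close> is empty, so everything
  cancels except one increment with the right sign
  (\<open>strongly_submodular_on_if_maxitive\<close>). For a non-decreasing \<open>f\<close> with \<open>f {} = 0\<close>, the choice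
  \<open>w x = f {x}\<close> gives a minorant of \<open>f\<close> that is exact on sets with at most one element; this is the
  case \<open>Y = {}\<close>.

  In general the elements of \<open>Y\<close> are contracted one at a time. For \<open>y \<in> Y\<close> split
  \<open>f = f' + d\<close> with \<open>f' A = f (insert y A) - f {y}\<close>, the marginal value of \<open>A\<close> over \<open>y\<close>, and
  \<open>d A = f A - f' A\<close>, the value that \<open>A\<close> shares with \<open>y\<close>. The function \<open>f'\<close> is again
  non-decreasing and submodular, and \<open>d\<close> is non-decreasing because \<open>f\<close> is submodular. So if \<open>g'\<close>
  solves the problem for \<open>f'\<close> and \<open>Y - {y}\<close>, then \<open>g' A + max\<^bsub>x\<in>A\<^esub> d {x}\<close> is below
  \<open>f' A + d A = f A\<close>, with equality on sets with at most one element. At \<open>Y\<close> nothing is lost either: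
  \<open>g'\<close> is non-decreasing and \<open>f'\<close> does not see \<open>y\<close>, so \<open>g' Y \<ge> g' (Y - {y}) = f' (Y - {y}) = f' Y\<close>,
  and the maximum at \<open>Y\<close> is at least \<open>d {y} = f {y}\<close>.
\<close>

section \<open>Strongly submodular functions\<close>

lemma strongly_submodular_onD:
  fixes m :: nat and A :: "nat \<Rightarrow> 'a set"
  assumes "strongly_submodular_on X g" and "m \<ge> 1" and "\<And>i. i \<in> {0..m} \<Longrightarrow> A i \<subseteq> X"
  shows "(\<Sum>K\<in>Pow {1..m}. (-1) ^ card K * g (A 0 \<union> (\<Union>i\<in>K. A i))) \<le> 0"
  using assms(1)[unfolded strongly_submodular_on_def, THEN spec[of _ m], THEN spec[of _ A]] assms(2,3)
  by simp

lemma strongly_submodular_on_add: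
  assumes "strongly_submodular_on X g" and "strongly_submodular_on X h"
  shows "strongly_submodular_on X (\<lambda>A. g A + h A)"
  unfolding strongly_submodular_on_def
proof (intro allI impI)
  fix m :: nat and A :: "nat \<Rightarrow> 'a set"
  assume mA: "m \<ge> 1" "\<forall>i\<in>{0..m}. A i \<subseteq> X"
  have "(\<Sum>K\<in>Pow {1..m}. (-1) ^ card K * g (A 0 \<union> (\<Union>i\<in>K. A i))) \<le> 0"
    and "(\<Sum>K\<in>Pow {1..m}. (-1) ^ card K * h (A 0 \<union> (\<Union>i\<in>K. A i))) \<le> 0"
    using mA strongly_submodular_onD[OF assms(1), of m A] strongly_submodular_onD[OF assms(2), of m A]
    by simp_all
  then show "(\<Sum>K\<in>Pow {1..m}. (-1) ^ card K *
      (g (A 0 \<union> (\<Union>i\<in>K. A i)) + h (A 0 \<union> (\<Union>i\<in>K. A i)))) \<le> 0"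
    by (simp add: distrib_left sum.distrib)
qed

text \<open>Monotonicity is the case \<open>m = 1\<close> of the defining inequality.\<close>

lemma strongly_submodular_on_mono:
  assumes "strongly_submodular_on X g"
  shows "mono_on (Pow X) g"
proof (rule mono_onI)
  fix A B assume AB: "A \<in> Pow X" "B \<in> Pow X" "A \<le> B"
  define C :: "nat \<Rightarrow> 'a set" where "C i = (if i = 0 then A else B)" for i
  have "(\<Sum>K\<in>Pow {1..1::nat}. (-1) ^ card K * g (C 0 \<union> (\<Union>i\<in>K. C i))) \<le> 0"
    using AB by (intro strongly_submodular_onD[OF assms]) (auto simp: C_def)
  moreover have "Pow {1..1::nat} = {{}, {1}}" by auto
  moreover have "A \<union> B = B" using AB by blast
  ultimately show "g A \<le> g B" by (simp add: C_def)
qed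

text \<open>
  With \<open>j\<close> minimising \<open>h (A j)\<close>, the terms for \<open>K\<close> and \<open>insert j K\<close> cancel for all nonempty \<open>K\<close>
  without \<open>j\<close>, and the pair for \<open>K = {}\<close> contributes \<open>h (A 0) - max (h (A 0)) (h (A j))\<close>.
\<close>

lemma strongly_submodular_on_if_maxitive:
  assumes maxitive: "\<And>A B. A \<subseteq> X \<Longrightarrow> B \<subseteq> X \<Longrightarrow> h (A \<union> B) = max (h A) (h B)"
  shows "strongly_submodular_on X h"
  unfolding strongly_submodular_on_def
proof (intro allI impI)
  fix m :: nat and A :: "nat \<Rightarrow> 'a set"
  assume m: "m \<ge> 1" and A: "\<forall>i\<in>{0..m}. A i \<subseteq> X"
  define F where "F K = h (A 0 \<union> (\<Union>i\<in>K. A i))" for K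
  obtain j where j: "j \<in> {1..m}" and least: "\<And>i. i \<in> {1..m} \<Longrightarrow> h (A j) \<le> h (A i)"
  proof -
    have "Min ((\<lambda>i. h (A i)) ` {1..m}) \<in> (\<lambda>i. h (A i)) ` {1..m}"
      using m by (intro Min_in) auto
    then obtain j where "j \<in> {1..m}" "h (A j) = Min ((\<lambda>i. h (A i)) ` {1..m})"
      by auto
    then show thesis by (intro that[of j]) auto
  qed
  define J where "J = {1..m} - {j}"
  have finJ: "finite J" and jJ: "j \<notin> J" and split: "{1..m} = insert j J"
    using j by (auto simp: J_def)
  have insertF: "F (insert j K) = max (h (A j)) (F K)" if "K \<subseteq> J" for K
  proof -
    have "A 0 \<union> (\<Union>i\<in>insert j K. A i) = A j \<union> (A 0 \<union> (\<Union>i\<in>K. A i))" by auto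
    moreover have "A 0 \<union> (\<Union>i\<in>K. A i) \<subseteq> X" "A j \<subseteq> X"
      using that A j by (fastforce simp: J_def)+
    ultimately show ?thesis unfolding F_def using maxitive by metis
  qed
  have absorb: "F (insert j K) = F K" if KJ: "K \<subseteq> J" "K \<noteq> {}" for K
  proof -
    obtain k where k: "k \<in> K" using KJ(2) by blast
    then have "A 0 \<union> (\<Union>i\<in>K. A i) = A k \<union> (A 0 \<union> (\<Union>i\<in>K. A i))" by auto
    moreover have "A 0 \<union> (\<Union>i\<in>K. A i) \<subseteq> X" "A k \<subseteq> X"
      using KJ(1) k A by (fastforce simp: J_def)+
    ultimately have "F K = max (h (A k)) (F K)"
      unfolding F_def using maxitive by metis
    moreover have "h (A j) \<le> h (A k)" using least k KJ(1) by (auto simp: J_def)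
    ultimately show ?thesis using insertF[OF KJ(1)] by linarith
  qed
  have "(\<Sum>K\<in>Pow {1..m}. (-1) ^ card K * F K)
      = (\<Sum>K\<in>Pow J. (-1) ^ card K * F K) + (\<Sum>K\<in>insert j ` Pow J. (-1) ^ card K * F K)"
    unfolding split Pow_insert using finJ jJ by (intro sum.union_disjoint) auto
  also have "(\<Sum>K\<in>insert j ` Pow J. (-1) ^ card K * F K)
      = (\<Sum>K\<in>Pow J. (-1) ^ card (insert j K) * F (insert j K))"
    using jJ by (intro sum.reindex[unfolded o_def] inj_onI) (auto simp: insert_ident)
  also have "\<dots> = (\<Sum>K\<in>Pow J. - ((-1) ^ card K * F (insert j K)))"
  proof (rule sum.cong[OF refl])
    fix K assume "K \<in> Pow J"
    then have "finite K" "j \<notin> K" using finJ jJ by (auto intro: finite_subset)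
    then show "(-1) ^ card (insert j K) * F (insert j K) = - ((-1) ^ card K * F (insert j K))"
      by simp
  qed
  also have "(\<Sum>K\<in>Pow J. (-1) ^ card K * F K) + \<dots>
      = (\<Sum>K\<in>Pow J. (-1) ^ card K * (F K - F (insert j K)))"
    by (simp add: sum.distrib[symmetric] algebra_simps)
  also have "\<dots> = (\<Sum>K\<in>{{}}. (-1) ^ card K * (F K - F (insert j K)))"
    using finJ absorb by (intro sum.mono_neutral_right) auto
  also have "\<dots> \<le> 0" using insertF[of "{}"] by simp
  finally show "(\<Sum>K\<in>Pow {1..m}. (-1) ^ card K * h (A 0 \<union> (\<Union>i\<in>K. A i))) \<le> 0"
    by (simp add: F_def)
qed

section \<open>The largest value on a singleton\<close>

text \<open>The \<open>0\<close> makes the maximum well defined, with value \<open>0\<close>, at the empty set.\<close>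

definition singleton_max :: "('a set \<Rightarrow> real) \<Rightarrow> 'a set \<Rightarrow> real" where
  "singleton_max d A = Max (insert 0 ((\<lambda>x. d {x}) ` A))"

lemma singleton_max_strongly_submodular:
  assumes "finite X"
  shows "strongly_submodular_on X (singleton_max d)"
proof (rule strongly_submodular_on_if_maxitive)
  fix A B assume "A \<subseteq> X" "B \<subseteq> X"
  then have "finite A" "finite B" using assms finite_subset by auto
  moreover have "insert 0 ((\<lambda>x. d {x}) ` (A \<union> B))
      = insert 0 ((\<lambda>x. d {x}) ` A) \<union> insert 0 ((\<lambda>x. d {x}) ` B)" by auto
  ultimately show "singleton_max d (A \<union> B) = max (singleton_max d A) (singleton_max d B)"
    unfolding singleton_max_def by (simp only:) (intro Max_Un, auto)
qed

lemma le_singleton_max: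
  assumes "finite A" and "x \<in> A"
  shows "d {x} \<le> singleton_max d A"
  using assms by (simp add: singleton_max_def)

lemma singleton_max_le:
  assumes "finite X" and "mono_on (Pow X) d" and "d {} = 0" and "A \<subseteq> X"
  shows "singleton_max d A \<le> d A"
proof -
  have "d B \<le> d A" if "B \<subseteq> A" for B
    using assms that by (auto intro: mono_onD[OF assms(2)])
  from this[of "{}"] this[of "{_}"] show ?thesis
    using assms(3) finite_subset[OF assms(4,1)] by (auto simp: singleton_max_def)
qed

lemma singleton_max_eq:
  assumes "finite X" and "mono_on (Pow X) d" and "d {} = 0" and "A \<subseteq> X" and "card A \<le> 1"
  shows "singleton_max d A = d A"
proof -
  have "finite A" using assms finite_subset by auto
  then consider "A = {}" | x where "A = {x}"
    using assms(5) by (cases "card A = 0") (auto simp: le_Suc_eq card_1_singleton_iff)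
  then show ?thesis
  proof cases
    case 1
    then show ?thesis using assms(3) by (simp add: singleton_max_def)
  next
    case 2
    then have "d A \<le> singleton_max d A" using le_singleton_max[of A x d] by simp
    with singleton_max_le[OF assms(1-4)] show ?thesis by simp
  qed
qed

section \<open>Contracting an element\<close>

lemma contraction_mono:
  fixes f :: "'a set \<Rightarrow> real"
  assumes "mono_on (Pow X) f" and "y \<in> X"
  shows "mono_on (Pow X) (\<lambda>A. f (insert y A) - f {y})"
proof (rule mono_onI)
  fix A B assume "A \<in> Pow X" "B \<in> Pow X" "A \<le> B"
  then have "f (insert y A) \<le> f (insert y B)"
    using assms(2) by (intro mono_onD[OF assms(1)]) auto
  then show "f (insert y A) - f {y} \<le> f (insert y B) - f {y}" by simp
qed

lemma contraction_submodular:
  assumes "submodular_on X f" and "y \<in> X"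
  shows "submodular_on X (\<lambda>A. f (insert y A) - f {y})"
  unfolding submodular_on_def
proof (intro allI impI)
  fix A B assume "A \<subseteq> X" "B \<subseteq> X"
  then have "f (insert y A \<union> insert y B) + f (insert y A \<inter> insert y B)
      \<le> f (insert y A) + f (insert y B)"
    using assms(1)[unfolded submodular_on_def, rule_format, of "insert y A" "insert y B"] assms(2)
    by simp
  moreover have "insert y A \<union> insert y B = insert y (A \<union> B)"
    and "insert y A \<inter> insert y B = insert y (A \<inter> B)" by auto
  ultimately show "f (insert y (A \<union> B)) - f {y} + (f (insert y (A \<inter> B)) - f {y})
      \<le> f (insert y A) - f {y} + (f (insert y B) - f {y})" by simp
qed

text \<open>
  The function is \<open>f {y}\<close> minus the gain \<open>f (insert y A) - f A\<close> from adding \<open>y\<close>, and by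
  submodularity this gain diminishes as \<open>A\<close> grows.
\<close>

lemma shared_value_mono:
  assumes "mono_on (Pow X) f" and "submodular_on X f" and y: "y \<in> X"
  shows "mono_on (Pow X) (\<lambda>A. f A - (f (insert y A) - f {y}))"
proof (rule mono_onI)
  fix A B assume AB: "A \<in> Pow X" "B \<in> Pow X" "A \<le> B"
  have "f (insert y A \<union> B) + f (insert y A \<inter> B) \<le> f (insert y A) + f B"
    using AB y assms(2)[unfolded submodular_on_def, rule_format, of "insert y A" B] by auto
  moreover have "insert y A \<union> B = insert y B" using AB by auto
  \<comment> \<open>The intersection is larger than \<open>A\<close> if \<open>y \<in> B - A\<close>; monotonicity covers that case.\<close>
  moreover have "f A \<le> f (insert y A \<inter> B)"
    using AB by (intro mono_onD[OF assms(1)]) auto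
  ultimately show "f A - (f (insert y A) - f {y}) \<le> f B - (f (insert y B) - f {y})" by simp
qed

section \<open>The strongly submodular minorant\<close>

lemma strongly_submodular_minorant:
  assumes "finite X" and "finite Y" and "Y \<subseteq> X"
    and "mono_on (Pow X) f" and "submodular_on X f" and "f {} = 0"
  shows "\<exists>g. strongly_submodular_on X g \<and> (\<forall>A. A \<subseteq> X \<longrightarrow> g A \<le> f A)
    \<and> (\<forall>A. A \<subseteq> X \<longrightarrow> A = Y \<or> card A \<le> 1 \<longrightarrow> g A = f A)"
  using assms(2-6)
proof (induction Y arbitrary: f rule: finite_induct)
  case empty
  then show ?case
    using singleton_max_strongly_submodular[OF assms(1), of f]
      singleton_max_le[OF assms(1), of f] singleton_max_eq[OF assms(1), of f]
    by (intro exI[of _ "singleton_max f"]) auto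
next
  case (insert y Y)
  define f' where "f' A = f (insert y A) - f {y}" for A
  define d where "d A = f A - f' A" for A
  have y: "y \<in> X" and Y: "Y \<subseteq> X" using insert.prems by auto
  have f': "mono_on (Pow X) f'" "submodular_on X f'" "f' {} = 0"
    using contraction_mono[OF insert.prems(2) y] contraction_submodular[OF insert.prems(3) y]
    by (simp_all add: f'_def[abs_def])
  obtain g' where g': "strongly_submodular_on X g'" "\<forall>A. A \<subseteq> X \<longrightarrow> g' A \<le> f' A"
    "\<forall>A. A \<subseteq> X \<longrightarrow> A = Y \<or> card A \<le> 1 \<longrightarrow> g' A = f' A"
    using insert.IH[OF Y f'] by (elim exE conjE)
  have d: "mono_on (Pow X) d" "d {} = 0"
    using shared_value_mono[OF insert.prems(2,3) y] f'(3) insert.prems(4)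
    by (simp_all add: d_def[abs_def] f'_def[abs_def])
  define g where "g A = g' A + singleton_max d A" for A
  have "strongly_submodular_on X g"
    unfolding g_def
    by (intro strongly_submodular_on_add g'(1) singleton_max_strongly_submodular assms(1))
  moreover have le: "g A \<le> f A" if "A \<subseteq> X" for A
    using g'(2)[rule_format, OF that] singleton_max_le[OF assms(1) d that] d_def[of A] by (simp add: g_def)
  moreover have "g A = f A" if "A \<subseteq> X" "card A \<le> 1" for A
    using g'(3) that singleton_max_eq[OF assms(1) d that] d_def[of A] by (simp add: g_def)
  moreover have "g (insert y Y) = f (insert y Y)"
  proof (rule antisym)
    show "g (insert y Y) \<le> f (insert y Y)" using le insert.prems(1) by blast
    have "f' Y \<le> g' (insert y Y)"
      using mono_onD[OF strongly_submodular_on_mono[OF g'(1)], of Y "insert y Y"]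
        g'(3) Y insert.prems(1) by auto
    moreover have "d {y} \<le> singleton_max d (insert y Y)"
      using insert.hyps(1) by (intro le_singleton_max) auto
    moreover have "d {y} = f {y}" by (simp add: d_def f'_def)
    ultimately show "f (insert y Y) \<le> g (insert y Y)" by (simp add: g_def f'_def)
  qed
  ultimately show ?case by (intro exI[of _ g]) auto
qed

theorem theorem12:
  fixes X :: "'a set" and f :: "'a set \<Rightarrow> real"
  assumes "finite X"
    and "mono_on (Pow X) f"
    and "submodular_on X f"
    and "f {} = 0"
  shows "\<forall>Y. Y \<subseteq> X \<longrightarrow>
    (\<exists>g :: 'a set \<Rightarrow> real. strongly_submodular_on X g
       \<and> (\<forall>A. A \<subseteq> X \<longrightarrow> g A \<le> f A)
       \<and> (\<forall>A. A \<subseteq> X \<longrightarrow> A = Y \<or> card A \<le> 1 \<longrightarrow> g A = f A))"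
proof (intro allI impI)
  fix Y assume Y: "Y \<subseteq> X"
  show "\<exists>g :: 'a set \<Rightarrow> real. strongly_submodular_on X g
       \<and> (\<forall>A. A \<subseteq> X \<longrightarrow> g A \<le> f A)
       \<and> (\<forall>A. A \<subseteq> X \<longrightarrow> A = Y \<or> card A \<le> 1 \<longrightarrow> g A = f A)"
    by (rule strongly_submodular_minorant[OF assms(1) finite_subset[OF Y assms(1)] Y assms(2-4)])
qed

end
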